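(* Let $U$ and $U_n$, $n\in\mathbb{N}$, be simply connected domains and let $F_n:U\to U_n$, $n\in\mathbb{N}$, be a sequence of holomorphic maps, each with a full radial extension. Suppose that there exists $\zeta_0\in\partial U$ such that $\operatorname{dist}(F_n(\zeta_0),\partial U_n)\to0$ as $n\to\infty$. If \[ L_0:=\{\zeta\in\partial U: |F_n(\zeta)-F_n(\zeta_0)|\to0\ \text{as } n\to\infty\} \] has positive harmonic measure with respect to $U$, then for all $z\in U$ we have \[ |F_n(z)-F_n(\zeta_0)|\to0\quad\text{as } n\to\infty . \] In particular, $L_0$ is contained in the Denjoy--Wolff set of $(F_n)$.
   Context: Simply connected domains are always assumed to be proper subsets of $\mathbb{C}$. $\operatorname{dist}$ is Euclidean distance. $\mathbb{D}$ is the unit disc. Harmonic measure. For a simply connected domain $U$, $z\in U$ and a conformal map $\varphi:\mathbb{D}\to U$ (onto) with $\varphi(0)=z$, the harmonic measure of a Borel set $A\subset\partial U$ is $\omega(z,A,U)=\lambda((\varphi^* )^{-1}(A))$, where $\lambda$ is normalised Lebesgue measure on $\partial\mathbb{D}$ and $\varphi^*(\xi)=\lim_{r\to1^-}\varphi(r\xi)$ at the points $\xi\in\partial\mathbb{D}$ where this radial limit exists and is finite. Sets of zero/positive/full harmonic measure do not depend on $z$. Radial extensions. A point $p\in\partial U$ is accessible from $U$ if there is an arc $\gamma:[0,1)\to U$ with $\gamma(t)\to p$ as $t\to1$; $\operatorname{AP}(U)$ is the set of such points. Let $f:U\to V$ be a holomorphic map between simply connected domains, $p\in\operatorname{AP}(U)$,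 and $\phi:\mathbb{D}\to U$ a Riemann map. A curve in $U$ approaches $p$ radially if it converges to $p$ and is the image under $\phi$ of a curve in $\mathbb{D}$ that approaches a point of $\partial\mathbb{D}$ nontangentially. $f$ has a radial extension to $p$ with value $f^*(p)$ if for every arc $\gamma(t)$, $t\in[0,1)$, in $U$ such that $\gamma(t)\to p$ radially as $t\to1$, we have $f(\gamma(t))\to f^*(p)$ as $t\to1$. $f$ has a full radial extension (to $\partial U$) if the domain of $f^*$ includes a subset of $\operatorname{AP}(U)$ of full harmonic measure with respect to $U$. The extension is again denoted by $f$; values $F_n(\zeta)$ with $\zeta\in\partial U$ (including $F_n(\zeta_0)$) are values of this extension, wherever defined, and lie in $\overline{U_n}$. Denjoy--Wolff set. If $\operatorname{dist}(F_n(z),\partial U_n)\to0$ as $n\to\infty$ for all $z\in U$, the Denjoy--Wolff set of $(F_n)$ is the set of $\zeta\in\partial U$ such that, for all $z\in U$, $|F_n(\zeta)-F_n(z)|\to0$ as $n\to\infty$. *)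

theory Defs
  imports "HOL-Complex_Analysis.Complex_Analysis"
begin

definition simply_connected_domain :: "complex set \<Rightarrow> bool" where
  "simply_connected_domain U \<longleftrightarrow>
     open U \<and> U \<noteq> {} \<and> U \<noteq> UNIV \<and> connected U \<and> simply_connected U"

definition riemann_map :: "(complex \<Rightarrow> complex) \<Rightarrow> complex set \<Rightarrow> bool" where
  "riemann_map \<phi> U \<longleftrightarrow>
     \<phi> holomorphic_on ball 0 1 \<and> inj_on \<phi> (ball 0 1) \<and> \<phi> ` ball 0 1 = U"

definition has_radial_limit :: "(complex \<Rightarrow> complex) \<Rightarrow> complex \<Rightarrow> complex \<Rightarrow> bool" where
  "has_radial_limit \<phi> \<xi> w \<longleftrightarrow> ((\<lambda>r. \<phi> (of_real r * \<xi>)) \<longlongrightarrow> w) (at_left (1::real))"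

text \<open>Normalised Lebesgue measure on the unit circle, in the parametrisation by the angle. As
  usual for \<^const>\<open>measure\<close>, a set that is not Lebesgue measurable gets the value 0; in
  particular, a positive value implies measurability.\<close>

definition circle_measure :: "complex set \<Rightarrow> real" where
  "circle_measure E = measure lebesgue {t \<in> {0..<2 * pi}. cis t \<in> E} / (2 * pi)"

text \<open>A Riemann map with prescribed value at 0 is unique up to a rotation of the disc, so the
  value below does not depend on the choice.\<close>

definition harmonic_measure :: "complex \<Rightarrow> complex set \<Rightarrow> complex set \<Rightarrow> real" where
  "harmonic_measure z A U =
     (let \<phi> = (SOME \<phi>. riemann_map \<phi> U \<and> \<phi> 0 = z)
      in circle_measure {\<xi> \<in> sphere 0 1. \<exists>w\<in>A. has_radial_limit \<phi> \<xi> w})"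

text \<open>Having positive or full harmonic measure does not depend on the base point, so quantifying
  it existentially or universally gives the same notion.\<close>

definition positive_harmonic_measure :: "complex set \<Rightarrow> complex set \<Rightarrow> bool" where
  "positive_harmonic_measure U A \<longleftrightarrow> (\<exists>z\<in>U. harmonic_measure z A U > 0)"

definition full_harmonic_measure :: "complex set \<Rightarrow> complex set \<Rightarrow> bool" where
  "full_harmonic_measure U A \<longleftrightarrow> (\<exists>z\<in>U. harmonic_measure z A U = 1)"

definition arc_to :: "(real \<Rightarrow> complex) \<Rightarrow> complex set \<Rightarrow> complex \<Rightarrow> bool" where
  "arc_to \<gamma> U p \<longleftrightarrow>
     continuous_on {0..<1} \<gamma> \<and> inj_on \<gamma> {0..<1} \<and> \<gamma> ` {0..<1} \<subseteq> U \<and>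
     (\<gamma> \<longlongrightarrow> p) (at_left 1)"

definition accessible_points :: "complex set \<Rightarrow> complex set" where
  "accessible_points U = {p \<in> frontier U. \<exists>\<gamma>. arc_to \<gamma> U p}"

text \<open>Nontangential approach: the curve tends to a point of the circle and finally stays in a
  Stolz angle at that point.\<close>

definition approaches_nontangentially :: "(real \<Rightarrow> complex) \<Rightarrow> complex \<Rightarrow> bool" where
  "approaches_nontangentially \<sigma> \<xi> \<longleftrightarrow>
     continuous_on {0..<1} \<sigma> \<and> \<sigma> ` {0..<1} \<subseteq> ball 0 1 \<and>
     (\<sigma> \<longlongrightarrow> \<xi>) (at_left 1) \<and>
     (\<exists>K. \<forall>\<^sub>F t in at_left 1. cmod (\<sigma> t - \<xi>) \<le> K * (1 - cmod (\<sigma> t)))"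

text \<open>Two Riemann maps onto the same domain differ by a disc automorphism, which preserves
  nontangential approach, so the choice of the Riemann map is immaterial.\<close>

definition approaches_radially :: "(real \<Rightarrow> complex) \<Rightarrow> complex set \<Rightarrow> complex \<Rightarrow> bool" where
  "approaches_radially \<gamma> U p \<longleftrightarrow>
     (\<gamma> \<longlongrightarrow> p) (at_left 1) \<and>
     (\<exists>\<phi> \<sigma> \<xi>. riemann_map \<phi> U \<and> \<xi> \<in> sphere 0 1 \<and> approaches_nontangentially \<sigma> \<xi> \<and>
        (\<forall>t\<in>{0..<1}. \<gamma> t = \<phi> (\<sigma> t)))"

definition has_radial_extension ::
    "(complex \<Rightarrow> complex) \<Rightarrow> complex set \<Rightarrow> complex \<Rightarrow> complex \<Rightarrow> bool" where
  "has_radial_extension f U p v \<longleftrightarrow>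
     p \<in> accessible_points U \<and>
     (\<forall>\<gamma>. arc_to \<gamma> U p \<and> approaches_radially \<gamma> U p \<longrightarrow> ((\<lambda>t. f (\<gamma> t)) \<longlongrightarrow> v) (at_left 1))"

definition radial_domain :: "(complex \<Rightarrow> complex) \<Rightarrow> complex set \<Rightarrow> complex set" where
  "radial_domain f U = {p. \<exists>v. has_radial_extension f U p v}"

text \<open>Every accessible boundary point is approached radially by some arc (Lindelof's theorem for
  the Riemann map), so the value is unique wherever it exists. It is only meaningful on
  \<^const>\<open>radial_domain\<close>.\<close>

definition radial_value :: "(complex \<Rightarrow> complex) \<Rightarrow> complex set \<Rightarrow> complex \<Rightarrow> complex" where
  "radial_value f U p = (SOME v. has_radial_extension f U p v)"

definition full_radial_extension :: "(complex \<Rightarrow> complex) \<Rightarrow> complex set \<Rightarrow> bool" where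
  "full_radial_extension f U \<longleftrightarrow>
     (\<exists>A. A \<subseteq> radial_domain f U \<and> A \<subseteq> accessible_points U \<and> full_harmonic_measure U A)"

text \<open>The points of the following two sets are those where all the boundary values involved are
  defined.\<close>

definition boundary_limit_set ::
    "(nat \<Rightarrow> complex \<Rightarrow> complex) \<Rightarrow> complex set \<Rightarrow> complex \<Rightarrow> complex set" where
  "boundary_limit_set F U \<zeta>\<^sub>0 =
     {\<zeta> \<in> frontier U. (\<forall>n. \<zeta> \<in> radial_domain (F n) U) \<and>
        (\<lambda>n. cmod (radial_value (F n) U \<zeta> - radial_value (F n) U \<zeta>\<^sub>0)) \<longlonglongrightarrow> 0}"

text \<open>The Denjoy--Wolff set is considered only for sequences of maps from \<open>U\<close> to \<open>V n\<close> such
  that the distance from \<open>F n z\<close> to the boundary of \<open>V n\<close> tends to 0 for all \<open>z \<in> U\<close>.\<close>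

definition denjoy_wolff_set :: "(nat \<Rightarrow> complex \<Rightarrow> complex) \<Rightarrow> complex set \<Rightarrow> complex set" where
  "denjoy_wolff_set F U =
     {\<zeta> \<in> frontier U. (\<forall>n. \<zeta> \<in> radial_domain (F n) U) \<and>
        (\<forall>z\<in>U. (\<lambda>n. cmod (radial_value (F n) U \<zeta> - F n z)) \<longlonglongrightarrow> 0)}"

end

theory Submission
  imports Defs
begin

text \<open>The point \<open>F\<^sub>n(\<zeta>\<^sub>0)\<close> may be replaced by a nearest point \<open>b\<^sub>n\<close> of the frontier of \<open>V\<^sub>n\<close>, so we
  study maps into simply connected domains that omit \<open>b\<^sub>n\<close>. For every \<open>R > 0\<close> such a domain carries
  a zero-free holomorphic \<open>g\<close> with \<open>|g| \<le> 1/2\<close> which is small near \<open>b\<^sub>n\<close> and bounded below at distance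
  at least \<open>R\<close> from \<open>b\<^sub>n\<close>, uniformly in the domain. If \<open>|F\<^sub>n(z) - b\<^sub>n| \<ge> R\<close> for infinitely many \<open>n\<close>,
  then the positive harmonic functions \<open>- ln |g\<^sub>n \<circ> F\<^sub>n \<circ> \<phi>|\<close> on the disc are bounded at one point, hence
  at 0 by Harnack's inequality, while their radial limits tend to infinity on a set of positive
  measure; two applications of Fatou's lemma to the mean value property exclude this.\<close>

section \<open>Components of closed sets, and inversion in the plane\<close>

text \<open>If the component \<open>C\<close> of \<open>x\<close> in
  \<open>K \<inter> cball x r\<close> missed the sphere, Sura-Bura would enclose it in a compact
  relatively clopen set \<open>T\<close> inside the open ball. Lying in the open ball,
  \<open>T\<close> is clopen in all of \<open>K\<close>, so it swallows the unbounded component of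
  \<open>x\<close> in \<open>K\<close>.\<close>

lemma boundary_bumping:
  fixes K :: "'a::euclidean_space set"
  assumes "closed K" "x \<in> K" "\<not> bounded (connected_component_set K x)" "r > 0"
  shows "\<exists>k. dist x k = r \<and> k \<in> connected_component_set (K \<inter> cball x r) x"
proof (rule ccontr)
  assume neg: "\<not> ?thesis"
  define C where "C = connected_component_set (K \<inter> cball x r) x"
  have cK: "compact (K \<inter> cball x r)"
    using assms(1) by (simp add: closed_Int_compact)
  have xK: "x \<in> K \<inter> cball x r" using assms by auto
  have Cc: "C \<in> components (K \<inter> cball x r)"
    unfolding C_def components_def using xK by blast
  have xC: "x \<in> C" unfolding C_def using xK by (simp add: connected_component_refl)
  have CK: "C \<subseteq> K \<inter> cball x r" using Cc in_components_subset by blast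
  have "C \<subseteq> ball x r"
  proof
    fix y assume "y \<in> C"
    then have "dist x y \<le> r" "dist x y \<noteq> r"
      using CK neg unfolding C_def by auto
    then show "y \<in> ball x r" by simp
  qed
  then obtain T where T: "openin (top_of_set (K \<inter> cball x r)) T" "compact T" "C \<subseteq> T" "T \<subseteq> ball x r"
    using Sura_Bura_clopen_subset[OF _ Cc compact_components[OF cK Cc] open_ball]
      closed_imp_locally_compact compact_imp_closed cK by metis
  obtain O' where O': "open O'" "T = (K \<inter> cball x r) \<inter> O'"
    using T(1) by (auto simp: openin_open)
  have "T = K \<inter> (O' \<inter> ball x r)" using O'(2) T(4) ball_subset_cball[of x r] by blast
  then have "openin (top_of_set K) T"
    using O'(1) by (metis open_Int open_ball openin_open_Int)
  moreover have "closedin (top_of_set K) T"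
    using compact_imp_closed[OF T(2)] O'(2) by (intro closed_subset) auto
  moreover have "connected_component_set K x \<inter> T \<noteq> {}"
    using xC T(3) assms(2) by (auto intro: connected_component_refl)
  ultimately have "connected_component_set K x \<subseteq> T"
  proof -
    assume o: "openin (top_of_set K) T" and c: "closedin (top_of_set K) T"
      and ne: "connected_component_set K x \<inter> T \<noteq> {}"
    let ?D = "connected_component_set K x"
    obtain P Q where "open P" "T = K \<inter> P" "closed Q" "T = K \<inter> Q"
      using o c by (auto simp: openin_open closedin_closed)
    moreover have "?D \<subseteq> K" by (rule connected_component_subset)
    ultimately have "?D \<inter> T = ?D \<inter> P" "?D \<inter> T = ?D \<inter> Q" by blast+
    then have "openin (top_of_set ?D) (?D \<inter> T)" "closedin (top_of_set ?D) (?D \<inter> T)"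
      using openin_open_Int[OF \<open>open P\<close>, of ?D] closedin_closed_Int[OF \<open>closed Q\<close>, of ?D] by simp_all
    then have "?D \<inter> T = ?D"
      using connected_clopen[of ?D] ne by (metis connected_connected_component)
    then show ?thesis by blast
  qed
  then show False using assms(3) bounded_subset[OF compact_imp_bounded[OF T(2)]] by metis
qed

text \<open>Inversion moves infinity to 0, so that \<open>W\<close> together with infinity becomes a
  plane domain on which square roots exist. Simple connectivity comes from the connectedness of
  \<open>- W\<close>: a bounded component of \<open>- W'\<close> would lie in a compact clopen part
  of \<open>- W'\<close>, whose inverse would be a proper clopen part of \<open>- W\<close>.\<close>

lemma simply_connected_inversion:
  fixes W K :: "complex set"
  assumes "connected K" "closed K" "W \<in> components (- K)" "0 \<in> K" "\<And>w. R < cmod w \<Longrightarrow> w \<in> W" "R > 0"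
  defines "W' \<equiv> insert 0 (inverse ` W)"
  shows "open W'" "simply_connected W'" "ball 0 (1/R) \<subseteq> W'"
proof -
  have oW: "open W" using assms(2,3) open_components by blast
  have W0: "0 \<notin> W" using assms(3,4) in_components_subset by blast
  show bW: "ball 0 (1/R) \<subseteq> W'"
  proof
    fix v :: complex assume v: "v \<in> ball 0 (1/R)"
    show "v \<in> W'"
    proof (cases "v = 0")
      case False
      with v have "R < cmod (inverse v)" using assms(6) by (simp add: norm_inverse norm_divide field_simps)
      then have "inverse v \<in> W" using assms(5) by blast
      then show ?thesis unfolding W'_def by (metis image_eqI inverse_inverse_eq insertCI)
    qed (simp add: W'_def)
  qed
  have iW: "inverse ` W = (- {0}) \<inter> inverse -` W"
    using W0 by (auto simp: image_iff) (metis inverse_inverse_eq)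
  have ci: "continuous_on (- {0}) (inverse :: complex \<Rightarrow> complex)"
    by (intro continuous_intros) auto
  have on0: "open (- {0::complex})" by (rule open_Compl) simp
  have oiW: "open (inverse ` W)"
    unfolding iW by (intro continuous_open_preimage[OF ci] on0 oW)
  have W'eq: "W' = inverse ` W \<union> ball 0 (1/R)"
  proof -
    have "0 \<in> ball (0::complex) (1/R)" using assms(6) by simp
    then show ?thesis using bW unfolding W'_def by blast
  qed
  show oW': "open W'" unfolding W'eq using oiW by blast
  have cW: "connected (inverse ` W)"
    using W0 in_components_connected[OF assms(3)]
    by (intro connected_continuous_image continuous_on_subset[OF ci]) auto
  have "inverse (of_real (2*R)) \<in> inverse ` W \<inter> ball 0 (1/R)"
  proof
    show "inverse (of_real (2*R)) \<in> inverse ` W"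
      by (intro imageI assms(5)) (use assms(6) in simp)
    show "inverse (of_real (2*R)) \<in> (ball 0 (1/R) :: complex set)"
    proof -
      have "cmod (inverse (of_real (2*R))) = inverse (2*R)"
        using assms(6) by (simp only: norm_inverse norm_of_real)
      also have "\<dots> < 1/R" using assms(6) by (simp add: field_simps)
      finally show ?thesis by simp
    qed
  qed
  then have cW': "connected W'"
    unfolding W'eq using cW by (intro connected_Un connected_ball) blast+
  have unb: "\<not> bounded C" if C: "C \<in> components (- W')" for C
  proof
    assume "bounded C"
    have clW': "closed (- W')" unfolding closed_def by (simp only: double_complement oW')
    have "closed C" by (rule closed_components[OF clW' C])
    then have "compact C" using \<open>bounded C\<close> by (simp add: compact_eq_bounded_closed)
    then obtain T where T: "openin (top_of_set (- W')) T" "compact T" "C \<subseteq> T"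
      using Sura_Bura_clopen_subset[OF closed_imp_locally_compact[OF clW'] C _ open_UNIV]
      by (metis subset_UNIV)
    obtain O' where O': "open O'" "T = (- W') \<inter> O'"
      using T(1) by (auto simp: openin_open)
    have T0: "0 \<notin> T" using O' unfolding W'_def by auto
    have Aeq: "inverse ` T = - W \<inter> ((- {0}) \<inter> inverse -` O')"
    proof (intro equalityI subsetI)
      fix w assume "w \<in> inverse ` T"
      then obtain v where "v \<in> T" "w = inverse v" by blast
      then show "w \<in> - W \<inter> ((- {0}) \<inter> inverse -` O')"
        using T0 O'(2) unfolding W'_def by auto
    next
      fix w assume w: "w \<in> - W \<inter> ((- {0}) \<inter> inverse -` O')"
      then have "inverse w \<in> T" using O'(2) unfolding W'_def by auto
      then show "w \<in> inverse ` T" by (metis image_eqI inverse_inverse_eq)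
    qed
    have "open ((- {0}) \<inter> inverse -` O')"
      by (intro continuous_open_preimage[OF ci] on0 O'(1))
    then have "openin (top_of_set (- W)) (inverse ` T)"
      unfolding Aeq by (rule openin_open_Int)
    moreover have "compact (inverse ` T)"
      using T0 T(2) by (intro compact_continuous_image continuous_on_subset[OF ci]) auto
    then have "closedin (top_of_set (- W)) (inverse ` T)"
      using Aeq by (intro closed_subset compact_imp_closed) simp_all
    moreover have "connected (- W)" using component_complement_connected assms(1,3) by blast
    ultimately have "inverse ` T = {} \<or> inverse ` T = - W"
      using connected_clopen by metis
    \<comment> \<open>The point 0 of \<open>- W\<close> corresponds to infinity under inversion,
      which the compact set \<open>T\<close> does not reach.\<close>
    moreover have "0 \<in> - W" "0 \<notin> inverse ` T" using W0 T0 by auto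
    moreover have "T \<noteq> {}" using T(3) C in_components_nonempty by blast
    ultimately show False by blast
  qed
  show "simply_connected W'"
    using simply_connected_eq_unbounded_complement_components[OF oW'] cW' unb by blast
qed

section \<open>Small zero-free functions near an omitted point\<close>

text \<open>For \<open>v = 1/w\<close> the branch is that of \<open>\<surd>((w - k)/w)\<close>, which equals 1 at infinity. It never
  takes the value -1, since its square is 1 only at \<open>v = 0\<close>; the lower bound quantifies this.\<close>

lemma sqrt_branch_bounds:
  fixes k :: complex
  assumes W: "open W" "simply_connected W" "ball 0 (1/R) \<subseteq> W" and k: "cmod k = R" "R > 0" "inverse k \<notin> W"
  shows "\<exists>\<sigma>. \<sigma> holomorphic_on W \<and> (\<forall>v\<in>W. (\<sigma> v)\<^sup>2 = 1 - k * v \<and> 1/3 \<le> cmod (\<sigma> v + 1))"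
proof -
  have k0: "k \<noteq> 0" using k by auto
  have nz: "1 - k * v \<noteq> 0" if "v \<in> W" for v
  proof
    assume "1 - k * v = 0"
    then have "v = inverse k" using k0 by (simp add: field_simps)
    then show False using that k(3) by simp
  qed
  have "(\<lambda>v. 1 - k * v) holomorphic_on W" by (intro holomorphic_intros)
  then obtain \<tau> where \<tau>: "\<tau> holomorphic_on W" "\<And>v. v \<in> W \<Longrightarrow> 1 - k * v = (\<tau> v)\<^sup>2"
    using simply_connected_eq_holomorphic_sqrt[OF W(1)] W(2) nz by blast
  have 0: "0 \<in> W" using W(3) k(2) by auto
  have "(\<tau> 0)\<^sup>2 = 1" using \<tau>(2)[OF 0] by simp
  then have \<tau>0: "\<tau> 0 = 1 \<or> \<tau> 0 = -1" by (simp add: power2_eq_1_iff)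
  \<comment> \<open>Since \<open>\<tau> 0\<close> is 1 or -1, this factor only fixes the sign so
    that \<open>\<sigma> 0 = 1\<close>.\<close>
  define \<sigma> where "\<sigma> v = \<tau> 0 * \<tau> v" for v
  have \<sigma>: "\<sigma> holomorphic_on W" unfolding \<sigma>_def using \<tau>(1) by (intro holomorphic_intros)
  have sq: "(\<sigma> v)\<^sup>2 = 1 - k * v" if "v \<in> W" for v
    unfolding \<sigma>_def using \<tau>(2)[OF that] \<tau>0 by (auto simp: power_mult_distrib)
  have \<sigma>0: "\<sigma> 0 = 1" unfolding \<sigma>_def using \<tau>0 by auto
  \<comment> \<open>On this disc \<open>1 - k * v\<close> has positive real part, so its square root
    is never purely imaginary; by connectedness \<open>Re \<sigma>\<close> keeps the sign it has at
    0.\<close>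
  have pos: "Re (\<sigma> v) > 0" if v: "v \<in> ball 0 (1/R)" for v
  proof (rule ccontr)
    assume neg: "\<not> 0 < Re (\<sigma> v)"
    have "connected ((\<lambda>v. Re (\<sigma> v)) ` ball 0 (1/R))"
      using holomorphic_on_imp_continuous_on[OF holomorphic_on_subset[OF \<sigma> W(3)]]
      by (intro connected_continuous_image continuous_intros) auto
    moreover have "Re (\<sigma> v) \<in> (\<lambda>v. Re (\<sigma> v)) ` ball 0 (1/R)" using v by blast
    moreover have "1 \<in> (\<lambda>v. Re (\<sigma> v)) ` ball 0 (1/R)"
      using \<sigma>0 k(2) by (intro image_eqI[of _ _ 0]) auto
    ultimately have "0 \<in> (\<lambda>v. Re (\<sigma> v)) ` ball 0 (1/R)"
      using neg by (intro connectedD_interval[of _ "Re (\<sigma> v)" 1 0]) auto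
    then obtain u where u: "u \<in> ball 0 (1/R)" "Re (\<sigma> u) = 0" by auto
    have "Re ((\<sigma> u)\<^sup>2) \<le> 0" using u(2) by (simp add: power2_eq_square)
    moreover have "Re (1 - k * u) > 0"
    proof -
      have "Re (k * u) \<le> R * cmod u" using complex_Re_le_cmod[of "k * u"] k(1) by (simp add: norm_mult)
      also have "\<dots> < 1" using u(1) k(2) by (simp add: field_simps)
      finally show ?thesis by simp
    qed
    ultimately show False using sq[of u] u(1) W(3) by auto
  qed
  have "1/3 \<le> cmod (\<sigma> v + 1)" if v: "v \<in> W" for v
  proof (cases "v \<in> ball 0 (1/R)")
    case True
    have "1 < Re (\<sigma> v + 1)" using pos[OF True] by simp
    then show ?thesis using complex_Re_le_cmod[of "\<sigma> v + 1"] by linarith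
  next
    case False
    show ?thesis
    proof (rule ccontr)
      assume lt: "\<not> ?thesis"
      \<comment> \<open>Off the disc the product of the distances from \<open>\<sigma> v\<close> to
        1 and -1 is \<open>R * cmod v\<close>, at least 1, whereas
        \<open>cmod (\<sigma> v + 1) < 1/3\<close> would make it at most 7/9.\<close>
      have "cmod (\<sigma> v - 1) \<le> cmod (\<sigma> v + 1) + 2"
        using norm_triangle_ineq[of "\<sigma> v + 1" "-2"] by simp
      then have "cmod (\<sigma> v + 1) * cmod (\<sigma> v - 1) \<le> (1/3) * (7/3)"
        using lt by (intro mult_mono) auto
      also have "cmod (\<sigma> v + 1) * cmod (\<sigma> v - 1) = cmod ((\<sigma> v)\<^sup>2 - 1)"
        unfolding norm_mult[symmetric] by (simp add: power2_eq_square algebra_simps)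
      also have "\<dots> = R * cmod v" using sq[OF v] k(1) by (simp add: norm_mult)
      finally have "R * cmod v < 1" by simp
      then show False using False k(2) by (simp add: field_simps)
    qed
  qed
  then show ?thesis using \<sigma> sq by blast
qed

text \<open>Since the component of 0 in the complement of \<open>V\<close> is unbounded, its part inside the disc of
  radius \<open>R\<close> contains a continuum \<open>K\<close> joining 0 to a point \<open>k\<close> with \<open>|k| = R\<close>. Unless \<open>V\<close> lies in the
  disc, it lies in the component of \<open>- K\<close> containing infinity, where \<open>\<sigma> = \<surd>((w - k)/w)\<close> has a branch
  that is near infinity as \<open>w\<close> tends to 0, and \<open>g\<close> is a multiple of \<open>1/(\<sigma> + 1)\<close>.\<close>

lemma bounded_function_small_near_zero:
  fixes V :: "complex set"
  assumes V: "open V" "simply_connected V" "0 \<notin> V" and R: "R > 0"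
  shows "\<exists>g. g holomorphic_on V \<and>
    (\<forall>w\<in>V. g w \<noteq> 0 \<and> cmod (g w) \<le> 1/2 \<and> (cmod (g w))\<^sup>2 \<le> cmod w / R \<and>
        (R \<le> cmod w \<longrightarrow> 1/18 \<le> cmod (g w)))"
proof (cases "V \<subseteq> cball 0 R")
  case True
  \<comment> \<open>For \<open>V\<close> inside the closed disc a multiple of the identity has all
    the required bounds.\<close>
  show ?thesis
  proof (intro exI[of _ "\<lambda>w. w / (2 * of_real R)"] conjI ballI impI)
    show "(\<lambda>w. w / (2 * of_real R)) holomorphic_on V"
      using R by (intro holomorphic_intros) auto
  next
    fix w assume w: "w \<in> V"
    then have wR: "cmod w \<le> R" using True by auto
    then have "cmod w * cmod w \<le> R * cmod w" by (intro mult_right_mono) auto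
    then have "cmod w * cmod w \<le> 4 * (R * cmod w)" using R by (smt (verit) mult_nonneg_nonneg norm_ge_zero)
    then show "(cmod (w / (2 * of_real R)))\<^sup>2 \<le> cmod w / R"
      using R by (simp add: norm_divide norm_mult power2_eq_square field_simps)
    show "w / (2 * of_real R) \<noteq> 0" using w V(3) R by auto
    show "cmod (w / (2 * of_real R)) \<le> 1/2"
      using wR R by (simp add: norm_divide norm_mult field_simps)
    show "1/18 \<le> cmod (w / (2 * of_real R))" if "R \<le> cmod w"
      using that R by (simp add: norm_divide norm_mult field_simps)
  qed
next
  case False
  have V_conn: "connected V" using V(2) simply_connected_imp_connected by blast
  have clV: "closed (- V)" using V(1) by (simp add: closed_Compl)
  have "connected_component_set (- V) 0 \<in> components (- V)"
    using V(3) unfolding components_def by blast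
  then have "\<not> bounded (connected_component_set (- V) 0)"
    using simply_connected_eq_unbounded_complement_components[OF V(1)] V(2) by blast
  then obtain k where k: "cmod k = R" "k \<in> connected_component_set (- V \<inter> cball 0 R) 0"
    using boundary_bumping[OF clV _ _ R, of 0] V(3) by auto
  define K where "K = connected_component_set (- V \<inter> cball 0 R) 0"
  have K: "connected K" "closed K" "K \<subseteq> - V \<inter> cball 0 R"
    unfolding K_def using clV
    by (auto intro!: closed_connected_component closed_Int simp: connected_component_subset
        dest: connected_component_in)
  have K0: "0 \<in> K" unfolding K_def using V(3) R by (simp add: connected_component_refl)
  have Vne: "V \<noteq> {}" "V \<subseteq> - K" using False K by auto
  obtain W where W: "W \<in> components (- K)" "V \<subseteq> W"
    using exists_component_superset[OF Vne(2) _ V_conn] Vne by blast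
  \<comment> \<open>The exterior of the disc is connected and misses \<open>K\<close>; it meets
    \<open>W\<close> because \<open>V\<close> leaves the disc.\<close>
  have "- cball 0 R \<subseteq> W"
  proof (rule components_maximal[OF W(1)])
    show "connected (- cball (0::complex) R)"
      by (rule connected_complement_bounded_convex) auto
    show "- cball 0 R \<subseteq> - K" using K(3) by blast
    show "W \<inter> - cball 0 R \<noteq> {}" using W(2) False by blast
  qed
  then have out: "w \<in> W" if "R < cmod w" for w using that by auto
  define W' where "W' = insert 0 (inverse ` W)"
  note W' = simply_connected_inversion[OF K(1,2) W(1) K0 out R, folded W'_def]
  have W0: "0 \<notin> W" using K0 W(1) in_components_subset by blast
  have "k \<in> K" using k(2) K_def by simp
  then have "k \<notin> W" using W(1) in_components_subset by blast
  moreover have k0: "k \<noteq> 0" using k(1) R by auto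
  ultimately have "inverse k \<notin> W'" unfolding W'_def by auto
  then obtain \<sigma> where \<sigma>: "\<sigma> holomorphic_on W'"
    "\<And>v. v \<in> W' \<Longrightarrow> (\<sigma> v)\<^sup>2 = 1 - k * v" "\<And>v. v \<in> W' \<Longrightarrow> 1/3 \<le> cmod (\<sigma> v + 1)"
    using sqrt_branch_bounds[OF W'(1,2,3) k(1) R] by blast
  define p where "p w = \<sigma> (inverse w) + 1" for w
  have inv: "inverse w \<in> W'" if "w \<in> V" for w using that W(2) unfolding W'_def by blast
  have w0: "w \<noteq> 0" if "w \<in> V" for w using that V(3) by blast
  have p3: "1/3 \<le> cmod (p w)" if "w \<in> V" for w
    unfolding p_def using \<sigma>(3) inv that by blast
  have "(\<lambda>w. \<sigma> (inverse w)) holomorphic_on V"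
  proof -
    have "inverse holomorphic_on V" using w0 by (intro holomorphic_on_inverse holomorphic_on_ident) auto
    then show ?thesis
      using holomorphic_on_compose_gen[OF _ \<sigma>(1)] inv unfolding o_def by blast
  qed
  then have holp: "p holomorphic_on V" unfolding p_def by (intro holomorphic_intros)
  have sq: "(p w - 1)\<^sup>2 = 1 - k / w" if "w \<in> V" for w
    unfolding p_def using \<sigma>(2)[OF inv[OF that]] by (simp add: divide_inverse)
  \<comment> \<open>The factor 6 turns the bound 1/3 below \<open>cmod (p w)\<close> into 1/2 above,
    and the bound 3, valid for \<open>R \<le> cmod w\<close>, into 1/18 below.\<close>
  show ?thesis
  proof (intro exI[of _ "\<lambda>w. 1 / (6 * p w)"] conjI ballI impI)
    show "(\<lambda>w. 1 / (6 * p w)) holomorphic_on V"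
      using p3 holp by (intro holomorphic_intros) force+
  next
    fix w assume w: "w \<in> V"
    have p: "1/3 \<le> cmod (p w)" "p w \<noteq> 0" using p3[OF w] by auto
    have wp: "0 < cmod w" using w0[OF w] by simp
    show "1 / (6 * p w) \<noteq> 0" using p by simp
    show "cmod (1 / (6 * p w)) \<le> 1/2"
      using p by (simp add: norm_divide norm_mult field_simps)
    have "R / cmod w - 1 \<le> cmod (1 - k / w)"
      using norm_triangle_ineq2[of "k / w" 1] k(1) by (simp add: norm_divide norm_minus_commute)
    also have "\<dots> = (cmod (p w - 1))\<^sup>2" using sq[OF w] by (metis norm_power)
    \<comment> \<open>From \<open>1 \<le> 3 * cmod (p w)\<close>. The same inequality squared then
      absorbs the summand 1, and 36 is the square of the factor 6.\<close>
    also have "\<dots> \<le> (4 * cmod (p w))\<^sup>2"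
      using p norm_triangle_ineq4[of "p w" 1] by (intro power_mono) auto
    finally have "R / cmod w \<le> 1 + 16 * (cmod (p w))\<^sup>2" by (simp add: power_mult_distrib)
    moreover have "(1/3)\<^sup>2 \<le> (cmod (p w))\<^sup>2" using p by (intro power_mono) auto
    ultimately have "R / cmod w \<le> 36 * (cmod (p w))\<^sup>2" by (simp add: power2_eq_square)
    then have "R \<le> 36 * (cmod (p w))\<^sup>2 * cmod w" using wp by (simp add: field_simps)
    then show "(cmod (1 / (6 * p w)))\<^sup>2 \<le> cmod w / R"
      using p R by (simp add: norm_divide norm_mult power_mult_distrib power_divide field_simps)
    show "1/18 \<le> cmod (1 / (6 * p w))" if "R \<le> cmod w"
    proof -
      have "(cmod (p w - 1))\<^sup>2 = cmod (1 - k / w)" using sq[OF w] by (metis norm_power)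
      also have "\<dots> \<le> 1 + R / cmod w" using norm_triangle_ineq4[of 1 "k/w"] k(1) by (simp add: norm_divide)
      also have "\<dots> \<le> 2\<^sup>2"
      proof -
        have "R / cmod w \<le> 1" using that wp by simp
        then show ?thesis by simp
      qed
      finally have "cmod (p w - 1) \<le> 2" by (rule power2_le_imp_le) simp
      then have "cmod (p w) \<le> 3" using norm_triangle_ineq[of "p w - 1" 1] by simp
      then show ?thesis using p by (simp add: norm_divide norm_mult field_simps)
    qed
  qed
qed

section \<open>Mean values, Harnack's inequality and Fatou's lemma\<close>

lemma mean_value_circle:
  assumes "f holomorphic_on ball 0 1" "0 < r" "r < 1"
  shows "((\<lambda>t. Re (f (of_real r * cis t))) has_integral 2 * pi * Re (f 0)) {0..2 * pi}"
proof -
  have "f holomorphic_on cball 0 r"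
    by (rule holomorphic_on_subset[OF assms(1)]) (use assms in auto)
  then have "((\<lambda>u. f u / (u - 0)) has_contour_integral (2 * of_real pi * \<i> * f 0)) (circlepath 0 r)"
    by (rule Cauchy_integral_circlepath_simple) (use assms in auto)
  then have "((\<lambda>t. f (0 + r * cis t) / (0 + r * cis t - 0) * r * \<i> * cis t) has_integral
      (2 * of_real pi * \<i> * f 0)) {0..2 * pi}"
    unfolding circlepath_def by (subst (asm) has_contour_integral_part_circlepath_iff) auto
  then have "((\<lambda>t. f (r * cis t) * \<i>) has_integral (2 * of_real pi * \<i> * f 0)) {0..2 * pi}"
    using assms(2) by (simp add: field_simps)
  from has_integral_mult_right[OF this, of "- \<i>"]
  have "((\<lambda>t. f (r * cis t)) has_integral (2 * of_real pi * f 0)) {0..2 * pi}"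
    by (simp add: algebra_simps)
  from has_integral_Re[OF this] show ?thesis by simp
qed

text \<open>The Schwarz lemma for the Cayley transform of \<open>f\<close>, in the direction that
  carries a bound at \<open>z\<close> to the centre.\<close>

lemma harnack_zero:
  assumes "f holomorphic_on ball 0 1" "\<And>z. z \<in> ball 0 1 \<Longrightarrow> 0 < Re (f z)" "z \<in> ball 0 1"
  shows "(1 - cmod z) * Re (f 0) \<le> (1 + cmod z) * Re (f z)"
proof -
  define a where "a = Re (f 0)"
  \<comment> \<open>Removing the imaginary part of \<open>f 0\<close> gives \<open>h 0 = a\<close>,
    so that \<open>k\<close> vanishes at 0.\<close>
  define h where "h w = f w - \<i> * Im (f 0)" for w
  define k where "k w = (h w - a) / (h w + a)" for w
  have a: "a > 0" unfolding a_def using assms(2) by simp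
  have Reh: "Re (h w) = Re (f w)" for w by (simp add: h_def)
  have nz: "h w + a \<noteq> 0" if "w \<in> ball 0 1" for w
  proof
    assume "h w + a = 0"
    then have "Re (h w + a) = 0" by simp
    then show False using assms(2)[OF that] a Reh by simp
  qed
  have holk: "k holomorphic_on ball 0 1"
    unfolding k_def h_def using nz assms(1) unfolding h_def by (intro holomorphic_intros) auto
  have h0: "h 0 = a" by (simp add: h_def a_def complex_eq_iff)
  have sq: "cmod (h w + a)^2 - cmod (h w - a)^2 = 4 * a * Re (h w)" for w
    unfolding cmod_power2 by (simp add: power2_eq_square algebra_simps)
  have lt: "cmod (k w) < 1" if "cmod w < 1" for w
  proof -
    have "cmod (h w - a)^2 < cmod (h w + a)^2"
      using sq[of w] a assms(2)[of w] that Reh by (smt (verit) mem_ball_0 mult_pos_pos)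
    then have "cmod (h w - a) < cmod (h w + a)" by (rule power_less_imp_less_base) simp
    then show ?thesis unfolding k_def using nz[of w] that by (simp add: norm_divide)
  qed
  have z: "cmod z < 1" using assms(3) by simp
  have "cmod (k z) \<le> cmod z"
    by (rule Schwarz_Lemma(1)[OF holk _ lt z]) (simp add: k_def h0)
  then have le: "cmod (h z - a) \<le> cmod z * cmod (h z + a)"
    unfolding k_def using nz[OF assms(3)] by (simp add: norm_divide field_simps)
  define x where "x = Re (h z)"
  define y where "y = Im (h z)"
  have x: "x > 0" unfolding x_def Reh using assms by simp
  have "cmod (h z - a)^2 \<le> (cmod z * cmod (h z + a))^2" using le by (intro power_mono) auto
  then have "(x - a)^2 + y^2 \<le> (cmod z)^2 * ((x + a)^2 + y^2)"
    by (simp add: cmod_power2 power_mult_distrib x_def y_def)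
  moreover have "(cmod z)^2 * y^2 \<le> 1 * y^2"
    using z by (intro mult_right_mono) (auto simp: power_le_one)
  ultimately have "(x - a)^2 \<le> (cmod z * (x + a))^2"
    unfolding power_mult_distrib distrib_left[of "(cmod z)\<^sup>2"] by linarith
  then have "\<bar>x - a\<bar> \<le> cmod z * (x + a)"
    using x a by (simp add: abs_le_square_iff[symmetric])
  then show ?thesis using Reh[of z] by (simp add: x_def a_def algebra_simps)
qed

text \<open>A uniform bound survives Fatou's lemma first in \<open>j\<close> and then in
  \<open>n\<close>. In the application \<open>j\<close> numbers radii tending to 1 and
  \<open>n\<close> the functions.\<close>

lemma iterated_fatou:
  fixes u :: "nat \<Rightarrow> nat \<Rightarrow> 'a \<Rightarrow> ennreal"
  assumes "\<And>n j. u n j \<in> borel_measurable M" "\<And>n j. (\<integral>\<^sup>+ x. u n j x \<partial>M) \<le> B"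
  shows "(\<integral>\<^sup>+ x. liminf (\<lambda>n. liminf (\<lambda>j. u n j x)) \<partial>M) \<le> B"
proof -
  have "(\<integral>\<^sup>+ x. liminf (\<lambda>j. u n j x) \<partial>M) \<le> B" for n
  proof -
    have "(\<integral>\<^sup>+ x. liminf (\<lambda>j. u n j x) \<partial>M) \<le> liminf (\<lambda>j. \<integral>\<^sup>+ x. u n j x \<partial>M)"
      using assms(1) by (rule nn_integral_liminf)
    also have "\<dots> \<le> liminf (\<lambda>j::nat. B)"
      using assms(2) by (intro Liminf_mono) auto
    finally show ?thesis by (simp add: Liminf_const)
  qed
  then have "liminf (\<lambda>n. \<integral>\<^sup>+ x. liminf (\<lambda>j. u n j x) \<partial>M) \<le> liminf (\<lambda>n::nat. B)"
    by (intro Liminf_mono) auto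
  moreover have "(\<integral>\<^sup>+ x. liminf (\<lambda>n. liminf (\<lambda>j. u n j x)) \<partial>M)
      \<le> liminf (\<lambda>n. \<integral>\<^sup>+ x. liminf (\<lambda>j. u n j x) \<partial>M)"
    using assms(1) by (intro nn_integral_liminf) measurable
  ultimately show ?thesis by (simp add: Liminf_const)
qed

text \<open>A Riemann map is composed with a disc automorphism that moves 0 to the preimage of
  \<open>z\<close>. This makes the choice in \<open>harmonic_measure\<close> meaningful.\<close>

lemma ex_riemann_map:
  assumes "simply_connected_domain U" "z \<in> U"
  shows "\<exists>\<phi>. riemann_map \<phi> U \<and> \<phi> 0 = z"
proof -
  obtain f g where f: "f holomorphic_on U" and g: "g holomorphic_on ball 0 1"
    and fg: "\<forall>z \<in> U. f z \<in> ball 0 1 \<and> g (f z) = z" "\<forall>z \<in> ball 0 1. g z \<in> U \<and> f (g z) = z"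
    using assms Riemann_mapping_theorem[of U] unfolding simply_connected_domain_def by blast
  have "f z \<in> ball 0 1" using fg assms by blast
  then obtain p q where p: "p (f z) = 0" "p holomorphic_on ball 0 1" "p ` ball 0 1 \<subseteq> ball 0 1"
    and q: "q holomorphic_on ball 0 1" "q ` ball 0 1 \<subseteq> ball 0 1"
    and pq: "\<And>w. w \<in> ball 0 1 \<Longrightarrow> p (q w) = w" "\<And>w. w \<in> ball 0 1 \<Longrightarrow> q (p w) = w"
    using ball_biholomorphism_exists by blast
  have "q 0 = f z" using p(1) pq(2) \<open>f z \<in> ball 0 1\<close> by metis
  moreover have "(g \<circ> q) holomorphic_on ball 0 1"
    using q g by (metis holomorphic_on_compose holomorphic_on_subset)
  moreover have "inj_on (g \<circ> q) (ball 0 1)"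
    by (intro comp_inj_on inj_on_inverseI[where g = p] inj_on_inverseI[where g = f])
      (use pq fg q(2) in auto)
  moreover have "(g \<circ> q) ` ball 0 1 = U"
  proof (intro equalityI subsetI)
    fix w assume "w \<in> U"
    then have "f w \<in> ball 0 1" "g (f w) = w" using fg by auto
    then have "(g \<circ> q) (p (f w)) = w" "p (f w) \<in> ball 0 1" using pq(2) p(3) by (simp, blast)
    then show "w \<in> (g \<circ> q) ` ball 0 1" by (metis image_eqI)
  qed (use fg q in auto)
  ultimately show ?thesis
    unfolding riemann_map_def using fg(1) assms(2) by (intro exI[of _ "g \<circ> q"]) auto
qed

text \<open>The bound at \<open>z\<close> becomes a bound on the means over all circles around 0.
  The limits stay iterated, radius before index, because how close to 1 the radius must be may
  depend on \<open>n\<close>.\<close>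

lemma positive_harmonic_blowup_null:
  fixes H :: "nat \<Rightarrow> complex \<Rightarrow> complex"
  assumes H: "\<And>n. H n holomorphic_on ball 0 1" "\<And>n z. z \<in> ball 0 1 \<Longrightarrow> 0 < Re (H n z)"
    and z: "z \<in> ball 0 1" "\<And>n. Re (H n z) \<le> B"
    and T: "T \<in> sets lebesgue" "T \<subseteq> {0..2 * pi}"
    and blowup: "\<And>t C. t \<in> T \<Longrightarrow>
      \<forall>\<^sub>F n in sequentially. \<forall>\<^sub>F r in at_left 1. C \<le> Re (H n (of_real r * cis t))"
  shows "emeasure lebesgue T = 0"
proof -
  \<comment> \<open>Fatou's lemma needs a sequence of radii; the double successor makes the first
    one 1/2 instead of 0.\<close>
  define \<rho> where "\<rho> j = 1 - inverse (real (Suc (Suc j)))" for j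
  have \<rho>: "0 < \<rho> j" "\<rho> j < 1" for j
    unfolding \<rho>_def by (auto simp: field_simps)
  have "\<rho> \<longlonglongrightarrow> 1 - 0"
    unfolding \<rho>_def by (intro tendsto_diff tendsto_const LIMSEQ_Suc[OF LIMSEQ_inverse_real_of_nat])
  then have \<rho>_lim: "filterlim \<rho> (at_left 1) sequentially"
    using \<rho>(2) by (intro filterlim_at_withinI always_eventually) (simp_all add: less_imp_neq)
  define M where "M = (1 + cmod z) * B / (1 - cmod z)"
  have H0: "Re (H n 0) \<le> M" for n
  proof -
    have "(1 - cmod z) * Re (H n 0) \<le> (1 + cmod z) * Re (H n z)"
      by (rule harnack_zero[OF H z(1)])
    also have "\<dots> \<le> (1 + cmod z) * B" using z(2) by (intro mult_left_mono) auto
    finally show ?thesis using z(1) unfolding M_def by (simp add: field_simps)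
  qed
  define u where "u n j t = ennreal (indicator {0..2 * pi} t * Re (H n (of_real (\<rho> j) * cis t)))" for n j t
  have in_disc: "of_real (\<rho> j) * cis t \<in> ball 0 1" for j t
    using \<rho>[of j] by (simp add: norm_mult)
  have meas: "u n j \<in> borel_measurable lborel" for n j
  proof -
    have "continuous_on UNIV (\<lambda>t. H n (of_real (\<rho> j) * cis t))"
      by (rule continuous_on_compose2[OF holomorphic_on_imp_continuous_on[OF H(1)]])
        (use in_disc in \<open>auto intro!: continuous_intros\<close>)
    then have "(\<lambda>t. Re (H n (of_real (\<rho> j) * cis t))) \<in> borel_measurable borel"
      by (intro borel_measurable_continuous_onI continuous_intros)
    then show ?thesis unfolding u_def by measurable
  qed
  have int: "(\<integral>\<^sup>+ t. u n j t \<partial>lborel) \<le> ennreal (2 * pi * M)" for n j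
  proof -
    have "(\<integral>\<^sup>+ t. u n j t \<partial>lborel) = ennreal (2 * pi * Re (H n 0))"
      unfolding u_def
      by (rule nn_integral_has_integral_lebesgue[OF _ mean_value_circle[OF H(1) \<rho>]])
        (use H(2) in_disc less_imp_le in blast)
    also have "\<dots> \<le> ennreal (2 * pi * M)" using H0 by (intro ennreal_leI mult_left_mono) auto
    finally show ?thesis .
  qed
  define L where "L t = liminf (\<lambda>n. liminf (\<lambda>j. u n j t))" for t
  have Linf: "L t = \<infinity>" if t: "t \<in> T" for t
  proof -
    have "ennreal C \<le> L t" for C
    proof -
      have "\<forall>\<^sub>F n in sequentially. ennreal C \<le> liminf (\<lambda>j. u n j t)"
        using blowup[OF t, of C]
      proof eventually_elim
        case (elim n)
        then have "\<forall>\<^sub>F j in sequentially. C \<le> Re (H n (of_real (\<rho> j) * cis t))"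
          using \<rho>_lim by (rule eventually_compose_filterlim)
        then have "\<forall>\<^sub>F j in sequentially. ennreal C \<le> u n j t"
          by eventually_elim (use t T(2) in \<open>auto simp: u_def intro!: ennreal_leI\<close>)
        then show ?case by (rule Liminf_bounded)
      qed
      then show ?thesis unfolding L_def by (rule Liminf_bounded)
    qed
    then have "L t \<ge> of_nat n" for n by (metis ennreal_of_nat_eq_real_of_nat)
    then show ?thesis by (metis ennreal_Ex_less_of_nat infinity_ennreal_def less_top linorder_not_less)
  qed
  \<comment> \<open>A finite bound on this product forces the measure to vanish. Since
    \<open>T\<close> is only Lebesgue measurable, the comparison takes place in the completion of
    \<open>lborel\<close>.\<close>
  have "\<infinity> * emeasure lebesgue T = (\<integral>\<^sup>+ t. \<infinity> * indicator T t \<partial>lebesgue)"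
    using T(1) by (simp add: nn_integral_cmult_indicator)
  also have "\<dots> \<le> (\<integral>\<^sup>+ t. L t \<partial>lebesgue)"
    by (intro nn_integral_mono) (use Linf in \<open>auto simp: indicator_def\<close>)
  also have "\<dots> = (\<integral>\<^sup>+ t. L t \<partial>lborel)" by (rule nn_integral_completion)
  also have "\<dots> \<le> ennreal (2 * pi * M)"
    unfolding L_def using meas int by (rule iterated_fatou)
  finally show ?thesis by (metis ennreal_mult_eq_top_iff ennreal_less_top infinity_ennreal_def leD)
qed

section \<open>Sequences of maps omitting a point\<close>

lemma bounded_function_small_near_omitted_point:
  fixes V :: "complex set"
  assumes V: "open V" "simply_connected V" "b \<notin> V" and R: "R > 0"
  shows "\<exists>g. g holomorphic_on V \<and>
    (\<forall>w\<in>V. g w \<noteq> 0 \<and> cmod (g w) \<le> 1/2 \<and> (cmod (g w))\<^sup>2 \<le> cmod (w - b) / R \<and>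
        (R \<le> cmod (w - b) \<longrightarrow> 1/18 \<le> cmod (g w)))"
proof -
  define V' where "V' = (\<lambda>w. - b + w) ` V"
  have "open V'" unfolding V'_def by (rule open_translation[OF V(1)])
  moreover have "simply_connected V'"
    unfolding V'_def using homeomorphic_simply_connected_eq[OF homeomorphic_translation] V(2) by blast
  moreover have "0 \<notin> V'"
  proof
    assume "0 \<in> V'"
    then obtain w where "w \<in> V" "0 = - b + w" unfolding V'_def by blast
    then show False using V(3) by (simp add: eq_neg_iff_add_eq_0)
  qed
  ultimately obtain g where g: "g holomorphic_on V'" "\<forall>w\<in>V'. g w \<noteq> 0 \<and> cmod (g w) \<le> 1/2 \<and>
      (cmod (g w))\<^sup>2 \<le> cmod w / R \<and> (R \<le> cmod w \<longrightarrow> 1/18 \<le> cmod (g w))"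
    using bounded_function_small_near_zero[OF _ _ _ R] by blast
  have "(\<lambda>w. - b + w) holomorphic_on V" by (intro holomorphic_intros)
  then have "(\<lambda>w. g (- b + w)) holomorphic_on V"
    using holomorphic_on_compose[of "\<lambda>w. - b + w" V g] g(1) by (simp add: o_def V'_def)
  then show ?thesis using g(2) by (intro exI[of _ "\<lambda>w. g (- b + w)"]) (simp add: V'_def)
qed

text \<open>The disc form of the theorem, with omitted points \<open>b n\<close> in place of the
  boundary values at \<open>\<zeta>\<^sub>0\<close>. A failure at \<open>z\<close> gives one
  \<open>R\<close> for a whole subsequence, which is the \<open>R\<close> for which the auxiliary
  functions are built.\<close>

lemma tendsto_omitted_points:
  fixes f :: "nat \<Rightarrow> complex \<Rightarrow> complex"
  assumes V: "\<And>n. open (V n)" "\<And>n. simply_connected (V n)" "\<And>n. b n \<notin> V n"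
    and f: "\<And>n. f n holomorphic_on ball 0 1" "\<And>n. f n ` ball 0 1 \<subseteq> V n"
    and T: "T \<in> sets lebesgue" "T \<subseteq> {0..2 * pi}" "emeasure lebesgue T \<noteq> 0"
    and L: "\<And>t n. t \<in> T \<Longrightarrow> ((\<lambda>r. f n (of_real r * cis t)) \<longlongrightarrow> L t n) (at_left 1)"
      "\<And>t. t \<in> T \<Longrightarrow> (\<lambda>n. L t n - b n) \<longlonglongrightarrow> 0"
    and z: "z \<in> ball 0 1"
  shows "(\<lambda>n. f n z - b n) \<longlonglongrightarrow> 0"
proof (rule ccontr)
  assume "\<not> ?thesis"
  then obtain R where R: "R > 0" "\<And>N. \<exists>n\<ge>N. R \<le> cmod (f n z - b n)"
    by (auto simp: LIMSEQ_iff not_less)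
  then have "infinite {n. R \<le> cmod (f n z - b n)}"
    unfolding infinite_nat_iff_unbounded_le by blast
  then obtain s :: "nat \<Rightarrow> nat" where s: "strict_mono s" "\<And>n. R \<le> cmod (f (s n) z - b (s n))"
    using infinite_enumerate by blast
  \<comment> \<open>Here \<open>Re H\<close> is \<open>- ln |g|\<close> along \<open>f n\<close>: it
    is positive as \<open>|g| \<le> 1/2\<close>, the exponential is \<open>|g|\<close> squared, and
    \<open>ln 18\<close> comes from the lower bound 1/18.\<close>
  have "\<exists>H. H holomorphic_on ball 0 1 \<and> (\<forall>x\<in>ball 0 1. 0 < Re (H x) \<and>
      exp (- 2 * Re (H x)) \<le> cmod (f n x - b n) / R \<and>
      (R \<le> cmod (f n x - b n) \<longrightarrow> Re (H x) \<le> ln 18))" for n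
  proof -
    obtain g where g: "g holomorphic_on V n" "\<And>w. w \<in> V n \<Longrightarrow> g w \<noteq> 0"
      "\<And>w. w \<in> V n \<Longrightarrow> cmod (g w) \<le> 1/2" "\<And>w. w \<in> V n \<Longrightarrow> (cmod (g w))\<^sup>2 \<le> cmod (w - b n) / R"
      "\<And>w. w \<in> V n \<Longrightarrow> R \<le> cmod (w - b n) \<Longrightarrow> 1/18 \<le> cmod (g w)"
      using bounded_function_small_near_omitted_point[OF V R(1), of n] by blast
    have fV: "f n x \<in> V n" if "x \<in> ball 0 1" for x using f(2) that by blast
    have "(\<lambda>x. g (f n x)) holomorphic_on ball 0 1"
      using holomorphic_on_compose_gen[OF f(1) g(1) f(2)] by (simp add: o_def)
    then obtain h where h: "h holomorphic_on ball 0 1" "\<And>x. x \<in> ball 0 1 \<Longrightarrow> g (f n x) = exp (h x)"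
      using simply_connected_eq_holomorphic_log[of "ball 0 1"] g(2) fV
      by (metis convex_ball convex_imp_simply_connected open_ball)
    have norm: "cmod (g (f n x)) = exp (Re (h x))" if "x \<in> ball 0 1" for x
      using h(2)[OF that] by simp
    show ?thesis
    proof (intro exI[of _ "\<lambda>x. - h x"] conjI ballI impI)
      show "(\<lambda>x. - h x) holomorphic_on ball 0 1" using h(1) by (intro holomorphic_intros)
      fix x :: complex assume x: "x \<in> ball 0 1"
      have "exp (Re (h x)) < exp 0"
        using g(3)[OF fV[OF x]] unfolding norm[OF x] exp_zero by linarith
      then show "0 < Re (- h x)" by simp
      show "exp (- 2 * Re (- h x)) \<le> cmod (f n x - b n) / R"
        using g(4)[OF fV[OF x]] norm[OF x] by (simp add: exp_double)
      show "Re (- h x) \<le> ln 18" if "R \<le> cmod (f n x - b n)"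
      proof -
        have "1/18 \<le> exp (Re (h x))" using g(5)[OF fV[OF x] that] norm[OF x] by simp
        then have "exp (Re (- h x)) \<le> 18" by (simp add: exp_minus field_simps)
        then show ?thesis by (simp add: ln_ge_iff)
      qed
    qed
  qed
  then obtain H where H: "\<And>n. H n holomorphic_on ball 0 1"
    "\<And>n x. x \<in> ball 0 1 \<Longrightarrow> 0 < Re (H n x)"
    "\<And>n x. x \<in> ball 0 1 \<Longrightarrow> exp (- 2 * Re (H n x)) \<le> cmod (f n x - b n) / R"
    "\<And>n x. x \<in> ball 0 1 \<Longrightarrow> R \<le> cmod (f n x - b n) \<Longrightarrow> Re (H n x) \<le> ln 18"
    by metis
  have "emeasure lebesgue T = 0"
  proof (rule positive_harmonic_blowup_null[OF _ _ z _ T(1,2), of "\<lambda>n. H (s n)" "ln 18"])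
    fix t C assume t: "t \<in> T"
    have "(\<lambda>n. L t (s n) - b (s n)) \<longlonglongrightarrow> 0"
      using LIMSEQ_subseq_LIMSEQ[OF L(2)[OF t] s(1)] by (simp add: o_def)
    \<comment> \<open>The threshold is chosen so that the exponential bound on \<open>H\<close>
      yields \<open>C \<le> Re H\<close>. Being strict, the inequality passes from the radial limit
      to radii near 1.\<close>
    then have "\<forall>\<^sub>F n in sequentially. cmod (L t (s n) - b (s n)) < R * exp (- 2 * C)"
      using R(1) by (auto simp: tendsto_iff dist_norm)
    then show "\<forall>\<^sub>F n in sequentially. \<forall>\<^sub>F r in at_left 1. C \<le> Re (H (s n) (of_real r * cis t))"
    proof eventually_elim
      case (elim n)
      have "((\<lambda>r. cmod (f (s n) (of_real r * cis t) - b (s n))) \<longlongrightarrow> cmod (L t (s n) - b (s n))) (at_left 1)"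
        by (intro tendsto_intros L(1) t)
      then have "\<forall>\<^sub>F r in at_left 1. cmod (f (s n) (of_real r * cis t) - b (s n)) < R * exp (- 2 * C)"
        using elim by (rule order_tendstoD)
      moreover have "\<forall>\<^sub>F r in at_left (1::real). 0 < r \<and> r < 1"
        by (simp add: eventually_at_left_real flip: greaterThanLessThan_iff)
      ultimately show ?case
      proof eventually_elim
        case (elim r)
        then have "of_real r * cis t \<in> ball 0 1" by (simp add: norm_mult)
        from H(3)[OF this, of "s n"] have "exp (- 2 * Re (H (s n) (of_real r * cis t))) < exp (- 2 * C)"
          using elim(1) R(1) by (smt (verit) divide_less_eq mult.commute)
        then show ?case by simp
      qed
    qed
  qed (use H s(2) z in auto)
  then show False using T(3) by blast
qed

section \<open>Boundary values along radii\<close>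

text \<open>This links the two kinds of boundary values: harmonic measure looks at radial limits of
  \<open>\<phi>\<close>, radial extensions at arcs in \<open>U\<close>. The image of a radius is
  such an arc.\<close>

lemma riemann_map_radius_radial:
  assumes \<phi>: "riemann_map \<phi> U" and \<xi>: "\<xi> \<in> sphere 0 1" and lim: "has_radial_limit \<phi> \<xi> p"
  shows "arc_to (\<lambda>r. \<phi> (of_real r * \<xi>)) U p" "approaches_radially (\<lambda>r. \<phi> (of_real r * \<xi>)) U p"
proof -
  have in_disc: "of_real r * \<xi> \<in> ball 0 1" if "r \<in> {0..<1}" for r :: real
    using that \<xi> by (simp add: norm_mult)
  have cont: "continuous_on {0..<1} (\<lambda>r. of_real r * \<xi>)" by (intro continuous_intros)
  have lim': "((\<lambda>r. of_real r * \<xi>) \<longlongrightarrow> \<xi>) (at_left 1)"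
  proof -
    have "((\<lambda>r. of_real r * \<xi>) \<longlongrightarrow> of_real 1 * \<xi>) (at_left 1)" by (intro tendsto_intros)
    then show ?thesis by simp
  qed
  have "inj_on (\<lambda>r. \<phi> (of_real r * \<xi>)) {0..<1}"
  proof (rule inj_onI)
    fix r r' :: real assume r: "r \<in> {0..<1}" "r' \<in> {0..<1}" "\<phi> (of_real r * \<xi>) = \<phi> (of_real r' * \<xi>)"
    then have "of_real r * \<xi> = of_real r' * \<xi>"
      using \<phi> in_disc unfolding riemann_map_def inj_on_def by blast
    then show "r = r'" using \<xi> by auto
  qed
  moreover have "continuous_on {0..<1} (\<lambda>r. \<phi> (of_real r * \<xi>))"
  proof (rule continuous_on_compose2[OF holomorphic_on_imp_continuous_on cont])
    show "\<phi> holomorphic_on ball 0 1" using \<phi> by (simp add: riemann_map_def)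
    show "(\<lambda>r. of_real r * \<xi>) ` {0..<1} \<subseteq> ball 0 1" using in_disc by blast
  qed
  moreover have "(\<lambda>r. \<phi> (of_real r * \<xi>)) ` {0..<1} \<subseteq> U"
  proof (rule image_subsetI)
    fix r :: real assume "r \<in> {0..<1}"
    then have "\<phi> (of_real r * \<xi>) \<in> \<phi> ` ball 0 1" using in_disc by blast
    then show "\<phi> (of_real r * \<xi>) \<in> U" using \<phi> by (simp add: riemann_map_def)
  qed
  ultimately show "arc_to (\<lambda>r. \<phi> (of_real r * \<xi>)) U p"
    unfolding arc_to_def using lim[unfolded has_radial_limit_def] by (intro conjI)
  have "\<forall>\<^sub>F r in at_left (1::real). 0 < r \<and> r < 1"
    by (simp add: eventually_at_left_real flip: greaterThanLessThan_iff)
  \<comment> \<open>On a radius both sides equal \<open>1 - r\<close>, so the Stolz constant is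
    1.\<close>
  then have "\<forall>\<^sub>F r in at_left 1. cmod (of_real r * \<xi> - \<xi>) \<le> 1 * (1 - cmod (of_real r * \<xi>))"
  proof eventually_elim
    case (elim r)
    have "of_real r * \<xi> - \<xi> = of_real (r - 1) * \<xi>" by (simp add: algebra_simps)
    then have "cmod (of_real r * \<xi> - \<xi>) = \<bar>r - 1\<bar> * cmod \<xi>" by (simp only: norm_mult norm_of_real)
    then show ?case using elim \<xi> by (simp add: norm_mult)
  qed
  then have "approaches_nontangentially (\<lambda>r. of_real r * \<xi>) \<xi>"
    unfolding approaches_nontangentially_def using cont lim' in_disc by blast
  then show "approaches_radially (\<lambda>r. \<phi> (of_real r * \<xi>)) U p"
    unfolding approaches_radially_def using lim \<phi> \<xi> unfolding has_radial_limit_def by blast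
qed

section \<open>Transfer from the disc to \<open>U\<close>\<close>

theorem theoremE:
  fixes U :: "complex set" and V :: "nat \<Rightarrow> complex set"
    and F :: "nat \<Rightarrow> complex \<Rightarrow> complex" and \<zeta>\<^sub>0 :: complex
  assumes "simply_connected_domain U"
    and "\<And>n. simply_connected_domain (V n)"
    and "\<And>n. F n holomorphic_on U"
    and "\<And>n. F n ` U \<subseteq> V n"
    and "\<And>n. full_radial_extension (F n) U"
    and "\<zeta>\<^sub>0 \<in> frontier U"
    and "\<And>n. \<zeta>\<^sub>0 \<in> radial_domain (F n) U"
    and "(\<lambda>n. infdist (radial_value (F n) U \<zeta>\<^sub>0) (frontier (V n))) \<longlonglongrightarrow> 0"
    and "positive_harmonic_measure U (boundary_limit_set F U \<zeta>\<^sub>0)"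
  shows "(\<forall>z\<in>U. (\<lambda>n. cmod (F n z - radial_value (F n) U \<zeta>\<^sub>0)) \<longlonglongrightarrow> 0)
    \<and> (\<forall>z\<in>U. (\<lambda>n. infdist (F n z) (frontier (V n))) \<longlonglongrightarrow> 0)
    \<and> boundary_limit_set F U \<zeta>\<^sub>0 \<subseteq> denjoy_wolff_set F U"
proof -
  define a where "a n = radial_value (F n) U \<zeta>\<^sub>0" for n
  define v where "v n p = radial_value (F n) U p" for n p
  have V: "open (V n)" "simply_connected (V n)" "frontier (V n) \<noteq> {}" for n
    using assms(2)[of n] unfolding simply_connected_domain_def
    by (auto simp: frontier_eq_empty)
  \<comment> \<open>A nearest frontier point exists because the frontier is closed and,
    \<open>V n\<close> being a nonempty proper open subset of the plane, nonempty.\<close>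
  have "\<exists>b. b \<in> frontier (V n) \<and> infdist (a n) (frontier (V n)) = dist (a n) b" for n
    using infdist_attains_inf[OF frontier_closed V(3)] by metis
  then obtain b where b: "\<And>n. b n \<in> frontier (V n)"
    "\<And>n. infdist (a n) (frontier (V n)) = dist (a n) (b n)" by metis
  have ab: "(\<lambda>n. a n - b n) \<longlonglongrightarrow> 0"
    using assms(8) b(2) unfolding a_def[symmetric] by (simp add: dist_norm tendsto_norm_zero_iff)
  have bV: "b n \<notin> V n" for n
    using b(1)[of n] V(1)[of n] by (simp add: frontier_def interior_open)
  obtain z0 where z0: "z0 \<in> U" "harmonic_measure z0 (boundary_limit_set F U \<zeta>\<^sub>0) U > 0"
    using assms(9) unfolding positive_harmonic_measure_def by blast
  define \<phi> where "\<phi> = (SOME \<phi>. riemann_map \<phi> U \<and> \<phi> 0 = z0)"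
  have \<phi>: "riemann_map \<phi> U"
    using someI_ex[OF ex_riemann_map[OF assms(1) z0(1)]] unfolding \<phi>_def by blast
  then have \<phi>': "\<phi> holomorphic_on ball 0 1" "\<phi> ` ball 0 1 = U" unfolding riemann_map_def by auto
  define T where "T = {t \<in> {0..<2 * pi}.
    cis t \<in> {\<xi> \<in> sphere 0 1. \<exists>w\<in>boundary_limit_set F U \<zeta>\<^sub>0. has_radial_limit \<phi> \<xi> w}}"
  have "measure lebesgue T > 0"
    using z0(2) unfolding harmonic_measure_def Let_def \<phi>_def[symmetric] circle_measure_def T_def
    by (simp add: zero_less_divide_iff)
  \<comment> \<open>A nonmeasurable set would have \<open>measure\<close> 0, so positivity also
    gives measurability.\<close>
  then have T: "T \<in> sets lebesgue" "emeasure lebesgue T \<noteq> 0"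
    using measure_notin_sets[of T lebesgue] by (auto simp: measure_def)
  have "\<exists>p. p \<in> boundary_limit_set F U \<zeta>\<^sub>0 \<and> has_radial_limit \<phi> (cis t) p" if "t \<in> T" for t
    using that unfolding T_def by blast
  then obtain p where p: "\<And>t. t \<in> T \<Longrightarrow> p t \<in> boundary_limit_set F U \<zeta>\<^sub>0"
    "\<And>t. t \<in> T \<Longrightarrow> has_radial_limit \<phi> (cis t) (p t)" by metis
  have va: "(\<lambda>n. v n q - a n) \<longlonglongrightarrow> 0" if "q \<in> boundary_limit_set F U \<zeta>\<^sub>0" for q
    using that unfolding boundary_limit_set_def v_def a_def by (simp add: tendsto_norm_zero_iff)
  have radial: "((\<lambda>r. F n (\<phi> (of_real r * cis t))) \<longlongrightarrow> v n (p t)) (at_left 1)" if t: "t \<in> T" for t n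
  proof -
    have "p t \<in> radial_domain (F n) U" using p(1)[OF t] unfolding boundary_limit_set_def by blast
    \<comment> \<open>On \<open>radial_domain\<close> the chosen value is a genuine one, and it
      governs the image of the radius ending at \<open>cis t\<close>.\<close>
    then have "has_radial_extension (F n) U (p t) (v n (p t))"
      unfolding radial_domain_def v_def radial_value_def by (auto intro: someI)
    then show ?thesis
      using riemann_map_radius_radial[OF \<phi> _ p(2)[OF t]] unfolding has_radial_extension_def by simp
  qed
  have Fb: "(\<lambda>n. F n z - b n) \<longlonglongrightarrow> 0" if "z \<in> U" for z
  proof -
    have "z \<in> \<phi> ` ball 0 1" using that \<phi>'(2) by simp
    then obtain x where x: "x \<in> ball 0 1" "\<phi> x = z" by (metis imageE)
    have "(\<lambda>n. F n (\<phi> x) - b n) \<longlonglongrightarrow> 0"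
    proof (rule tendsto_omitted_points[OF V(1,2) bV _ _ T(1) _ T(2) radial _ x(1)])
      show "(\<lambda>x. F n (\<phi> x)) holomorphic_on ball 0 1" for n
        using holomorphic_on_compose_gen[OF \<phi>'(1) assms(3)] \<phi>'(2) by (simp add: o_def)
      show "(\<lambda>x. F n (\<phi> x)) ` ball 0 1 \<subseteq> V n" for n
        using assms(4)[of n] unfolding \<phi>'(2)[symmetric] image_image .
      show "T \<subseteq> {0..2 * pi}" unfolding T_def by auto
      show "(\<lambda>n. v n (p t) - b n) \<longlonglongrightarrow> 0" if "t \<in> T" for t
        using tendsto_add[OF va[OF p(1)[OF that]] ab] by simp
    qed auto
    then show ?thesis using x(2) by simp
  qed
  have Fa: "(\<lambda>n. F n z - a n) \<longlonglongrightarrow> 0" if "z \<in> U" for z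
    using tendsto_diff[OF Fb[OF that] ab] by simp
  \<comment> \<open>As \<open>b n\<close> lies on the frontier, closeness to \<open>b n\<close>
    gives the standing assumption under which the Denjoy-Wolff set is considered.\<close>
  have "(\<lambda>n. infdist (F n z) (frontier (V n))) \<longlonglongrightarrow> 0" if "z \<in> U" for z
  proof (rule tendsto_sandwich[OF _ _ tendsto_const tendsto_norm_zero[OF Fb[OF that]]])
    show "\<forall>\<^sub>F n in sequentially. infdist (F n z) (frontier (V n)) \<le> cmod (F n z - b n)"
      using infdist_le[OF b(1)] by (simp add: dist_norm)
  qed (simp add: infdist_nonneg)
  moreover have "boundary_limit_set F U \<zeta>\<^sub>0 \<subseteq> denjoy_wolff_set F U"
  proof
    fix q assume q: "q \<in> boundary_limit_set F U \<zeta>\<^sub>0"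
    have "(\<lambda>n. cmod (v n q - F n z)) \<longlonglongrightarrow> 0" if "z \<in> U" for z
      using tendsto_norm[OF tendsto_diff[OF va[OF q] Fa[OF that]]] by simp
    moreover have "q \<in> frontier U" "\<forall>n. q \<in> radial_domain (F n) U"
      using q unfolding boundary_limit_set_def by simp_all
    ultimately show "q \<in> denjoy_wolff_set F U"
      unfolding denjoy_wolff_set_def v_def by simp
  qed
  moreover have "(\<lambda>n. cmod (F n z - radial_value (F n) U \<zeta>\<^sub>0)) \<longlonglongrightarrow> 0" if "z \<in> U" for z
    using tendsto_norm_zero[OF Fa[OF that]] by (simp add: a_def)
  ultimately show ?thesis by blast
qed

end
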